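(* (i) If $G$ is a connected graph, then $a_u(G)$ is at most the minimum size of a maximal matching in $G$. (ii) For $m,k\in\mathbb{N}$ with $k\ge 4$, some graph $G_{m,k}$ with maximum degree $k$ has a maximal matching of size $m$ and satisfies $a_u(G_{m,k})=m$, achieving equality in the bound of (i).
   Context: Graphs are finite, simple and undirected, and $\mathbb{N}$ is the set of positive integers. The vertices of a graph carry nonnegative integer weights. A unit acquisition move transfers one unit of weight from a vertex $u$ of positive weight to a neighbor $v$ of $u$, under the condition that before the move the weight of $v$ is at least the weight of $u$. The unit acquisition number $a_u(G)$ is the minimum size to which the set of vertices with positive weight can be reduced via successive unit acquisition moves, starting from the configuration in which every vertex has weight $1$. A matching is maximal if it is not properly contained in another matching.
   Formalization: Part (i) is stated for connected graphs with at least two vertices; for the one-vertex graph the English claim fails, since its unit acquisition number is 1 while its only maximal matching is empty (size 0). *)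

theory Defs
  imports "Graph_Theory.Graph_Theory"
begin

text \<open>
  A finite simple undirected graph is a \<open>pair_graph\<close>: finite, loop-free, and with a symmetric arc
  relation, so that each undirected edge is represented by two opposite arcs. Consequently the
  degree of a vertex is its out-degree, whereas matchings have to be formed from the two-element
  sets underlying the arcs.
\<close>

definition max_degree :: "'a pair_pre_digraph \<Rightarrow> nat" where
  "max_degree G = Max (out_degree (with_proj G) ` pverts G)"

definition uedges :: "'a pair_pre_digraph \<Rightarrow> 'a set set" where
  "uedges G = {{u, v} | u v. (u, v) \<in> parcs G}"

definition matching :: "'a pair_pre_digraph \<Rightarrow> 'a set set \<Rightarrow> bool" where
  "matching G M \<longleftrightarrow> M \<subseteq> uedges G \<and> pairwise disjnt M"

definition maximal_matching :: "'a pair_pre_digraph \<Rightarrow> 'a set set \<Rightarrow> bool" where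
  "maximal_matching G M \<longleftrightarrow> matching G M \<and> \<not> (\<exists>M'. matching G M' \<and> M \<subset> M')"

text \<open>On a \<open>pair_graph\<close> the sets of numbers below are nonempty, so both minima are attained.\<close>

definition min_maximal_matching_size :: "'a pair_pre_digraph \<Rightarrow> nat" where
  "min_maximal_matching_size G = (LEAST n. \<exists>M. maximal_matching G M \<and> card M = n)"

definition unit_acquisition_move ::
    "'a pair_pre_digraph \<Rightarrow> ('a \<Rightarrow> nat) \<Rightarrow> ('a \<Rightarrow> nat) \<Rightarrow> bool" where
  "unit_acquisition_move G w w' \<longleftrightarrow>
    (\<exists>u v. (u, v) \<in> parcs G \<and> 0 < w u \<and> w u \<le> w v \<and> w' = w(u := w u - 1, v := w v + 1))"

definition initial_weight :: "'a pair_pre_digraph \<Rightarrow> 'a \<Rightarrow> nat" where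
  "initial_weight G v = (if v \<in> pverts G then 1 else 0)"

definition unit_acquisition_number :: "'a pair_pre_digraph \<Rightarrow> nat" where
  "unit_acquisition_number G =
    (LEAST n. \<exists>w. (unit_acquisition_move G)\<^sup>*\<^sup>* (initial_weight G) w \<and>
                  card {v \<in> pverts G. 0 < w v} = n)"

end

theory Submission
  imports Defs
begin

text \<open>
  Upper bound. The vertices covered by a maximal matching \<open>M\<close> meet every edge, and a connected
  graph with at least two vertices has no isolated vertex, so every uncovered vertex has a covered
  neighbour. Let each uncovered vertex send its unit of weight to such a neighbour; this is always
  allowed, because covered vertices have weight at least \<open>1\<close>. Afterwards only covered vertices carry
  weight, and on each edge of \<open>M\<close> the lighter end can be emptied into the heavier one, unit by unit.
  At most one vertex per edge of \<open>M\<close> keeps positive weight.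

  Sharpness. The graph \<open>star_chain m k\<close> consists of \<open>m\<close> stars with \<open>k\<close> leaves each, where
  consecutive stars share one leaf. The centres form a vertex cover, and pairing every centre with a
  leaf of its own gives a maximal matching of size \<open>m\<close>. By the upper bound, what remains is to show
  that at least \<open>m\<close> vertices always keep positive weight.

  This lower bound rests on the fact that a vertex of weight \<open>0\<close> can never receive weight again: it
  is dead, while vertices of positive weight are live. A leaf shared by two centres has weight at most
  \<open>1\<close> until it first receives; the move that raises it to \<open>2\<close> takes the last unit of a centre, so from
  then on that leaf has at most one live neighbour. Hence a centre can pass on weight without dying
  only to a leaf for which it is the last live neighbour. A centre that has taken the weight of its
  pendant leaves must do so in order to return to weight \<open>1\<close>.
  Consequently, whenever a centre has weight \<open>1\<close> it still has a live neighbour in reserve: either a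
  pendant leaf, or a shared leaf whose other centre is dead. When the centre dies, this neighbour
  is left with no live neighbour at all, so its weight can never change again, and it can replace the
  centre in the count. The number of live centres plus the number of leaves stuck in this way
  therefore never decreases; it starts at the number of centres. The lemma
  \<open>settling_invariant_step\<close> carries this argument, for any bipartite graph whose
  leaf side has degrees at most \<open>2\<close>.
\<close>

section \<open>Collapsing a graph onto a maximal matching\<close>

text \<open>Moving a unit from \<open>u\<close> to \<open>v\<close> preserves \<open>w u \<le> w v\<close>, so the moves can be repeated.\<close>

lemma drain_arc:
  assumes "(u, v) \<in> parcs G" "u \<noteq> v" "w u \<le> w v"
  shows "(unit_acquisition_move G)\<^sup>*\<^sup>* w (w(u := 0, v := w u + w v))"
  using assms(3)
proof (induction "w u" arbitrary: w)
  case 0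
  then show ?case by (simp add: fun_upd_idem)
next
  case (Suc n)
  define w' where "w' = w(u := w u - 1, v := w v + 1)"
  have "unit_acquisition_move G w w'"
    unfolding unit_acquisition_move_def w'_def
    using assms(1) Suc.hyps(2) Suc.prems by (intro exI[of _ u] exI[of _ v]) auto
  moreover have "n = w' u" "w' u \<le> w' v"
    using Suc.hyps(2) Suc.prems assms(2) by (auto simp: w'_def)
  from Suc.hyps(1)[OF this]
  have "(unit_acquisition_move G)\<^sup>*\<^sup>* w' (w'(u := 0, v := w' u + w' v))" .
  moreover have "w'(u := 0, v := w' u + w' v) = w(u := 0, v := w u + w v)"
    using Suc.hyps(2) assms(2) by (auto simp: w'_def fun_eq_iff)
  ultimately show ?case by (metis converse_rtranclp_into_rtranclp)
qed

text \<open>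
  The targets in \<open>C\<close> only gain weight, so they never become too light to accept the unit of the next
  vertex of \<open>U\<close>.
\<close>

lemma drain_uncovered:
  assumes nbr: "\<And>u. u \<in> U \<Longrightarrow> \<exists>v\<in>C. (u, v) \<in> parcs G"
    and "U \<inter> C = {}" "finite U"
    and "\<And>u. u \<in> U \<Longrightarrow> w u = 1" "\<And>v. v \<in> C \<Longrightarrow> 1 \<le> w v"
  shows "\<exists>w'. (unit_acquisition_move G)\<^sup>*\<^sup>* w w' \<and> (\<forall>u\<in>U. w' u = 0) \<and>
    (\<forall>v\<in>C. 1 \<le> w' v) \<and> (\<forall>x. x \<notin> U \<union> C \<longrightarrow> w' x = w x)"
  using assms(3,1,2,4)
proof (induction U rule: finite_induct)
  case empty
  then show ?case using assms(5) by blast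
next
  case (insert u U)
  obtain w' where w': "(unit_acquisition_move G)\<^sup>*\<^sup>* w w'" "\<forall>u\<in>U. w' u = 0"
    "\<forall>v\<in>C. 1 \<le> w' v" "\<forall>x. x \<notin> U \<union> C \<longrightarrow> w' x = w x"
    using insert.IH insert.prems by auto
  obtain v where v: "v \<in> C" "(u, v) \<in> parcs G"
    using insert.prems(1) by blast
  have u: "u \<notin> C" "w' u = 1"
    using insert.prems insert.hyps w'(4) by auto
  let ?w = "w'(u := 0, v := w' u + w' v)"
  have "(unit_acquisition_move G)\<^sup>*\<^sup>* w' ?w"
    using v u w'(3) by (intro drain_arc) auto
  then have "(unit_acquisition_move G)\<^sup>*\<^sup>* w ?w"
    using w'(1) by (rule rtranclp_trans[rotated])
  moreover have "\<forall>x\<in>insert u U. ?w x = 0" "\<forall>x\<in>C. 1 \<le> ?w x"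
    "\<forall>x. x \<notin> insert u U \<union> C \<longrightarrow> ?w x = w x"
    using w'(2-4) v u insert.prems(2) by auto
  ultimately show ?case by blast
qed

text \<open>The edges of a matching are disjoint, so emptying one end of each of them does not interfere.\<close>

lemma collapse_matching:
  assumes "finite N" "N \<subseteq> uedges G" "pairwise disjnt N" "\<And>v. (v, v) \<notin> parcs G"
    and sym: "\<And>u v. (u, v) \<in> parcs G \<Longrightarrow> (v, u) \<in> parcs G"
  shows "\<exists>w'. (unit_acquisition_move G)\<^sup>*\<^sup>* w w' \<and> (\<forall>e\<in>N. card {v\<in>e. 0 < w' v} \<le> 1) \<and>
    (\<forall>x. x \<notin> \<Union>N \<longrightarrow> w' x = w x)"
  using assms(1-3)
proof (induction N rule: finite_induct)
  case empty
  then show ?case by auto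
next
  case (insert e N)
  obtain w' where w': "(unit_acquisition_move G)\<^sup>*\<^sup>* w w'"
    "\<forall>e\<in>N. card {v\<in>e. 0 < w' v} \<le> 1" "\<forall>x. x \<notin> \<Union>N \<longrightarrow> w' x = w x"
    using insert.IH insert.prems by (auto simp: pairwise_insert)
  obtain a b where ab: "e = {a, b}" "(a, b) \<in> parcs G"
    using insert.prems(1) by (auto simp: uedges_def)
  then obtain u v where e: "e = {u, v}" "(u, v) \<in> parcs G" "w' u \<le> w' v"
    using sym[OF ab(2)] by (metis insert_commute nat_le_linear)
  have "u \<noteq> v" using e(2) assms(4) by auto
  let ?w = "w'(u := 0, v := w' u + w' v)"
  have "(unit_acquisition_move G)\<^sup>*\<^sup>* w' ?w"
    using drain_arc[OF e(2) \<open>u \<noteq> v\<close> e(3)] .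
  then have "(unit_acquisition_move G)\<^sup>*\<^sup>* w ?w"
    using w'(1) by simp
  moreover have "card {x\<in>e. 0 < ?w x} \<le> 1"
  proof -
    have "{x\<in>e. 0 < ?w x} \<subseteq> {v}" using e(1) by auto
    then show ?thesis using card_mono[of "{v}"] by fastforce
  qed
  moreover have "card {x\<in>f. 0 < ?w x} \<le> 1" if f: "f \<in> N" for f
  proof -
    have "disjnt e f" using insert.prems(2) insert.hyps(2) f
      by (auto simp: pairwise_insert)
    then have "{x\<in>f. 0 < ?w x} = {x\<in>f. 0 < w' x}"
      using e(1) by (auto simp: disjnt_def)
    then show ?thesis using w'(2) f by simp
  qed
  moreover have "\<forall>x. x \<notin> \<Union>(insert e N) \<longrightarrow> ?w x = w x"
    using w'(3) e(1) by auto
  ultimately show ?case by blast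
qed

lemma uncovered_vertex_adjacent_to_covered:
  assumes M: "maximal_matching G M" and "(u, v) \<in> parcs G" "u \<notin> \<Union>M"
  shows "v \<in> \<Union>M"
proof (rule ccontr)
  assume v: "v \<notin> \<Union>M"
  have "matching G (insert {u, v} M)"
    using M assms(2,3) v
    by (auto simp: maximal_matching_def matching_def uedges_def pairwise_insert disjnt_def)
  moreover have "M \<subset> insert {u, v} M" using assms(3) by auto
  ultimately show False using M by (auto simp: maximal_matching_def)
qed

lemma connected_imp_no_isolated_vertex:
  assumes "pair_graph G" "connected (with_proj G)" "2 \<le> card (pverts G)" "u \<in> pverts G"
  shows "\<exists>v. (u, v) \<in> parcs G"
proof -
  interpret pair_graph G by fact
  have "\<not> pverts G \<subseteq> {u}"
    using assms(3) card_mono[of "{u}" "pverts G"] by auto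
  then obtain x where x: "x \<in> pverts G" "x \<noteq> u" by blast
  have "strongly_connected (with_proj G)"
    using assms(2) pair_sym_arcs by (intro symmetric_connected_imp_strongly_connected)
  then have "u \<rightarrow>\<^sup>*\<^bsub>with_proj G\<^esub> x"
    using x assms(4) by (simp add: strongly_connected_def)
  then show ?thesis using x(2)
    by (cases rule: converse_reachable_cases) auto
qed

lemma finite_uedges:
  assumes "finite (parcs G)"
  shows "finite (uedges G)"
proof -
  have "uedges G = (\<lambda>(u, v). {u, v}) ` parcs G" by (auto simp: uedges_def)
  then show ?thesis using assms by simp
qed

lemma unit_acquisition_number_le:
  assumes "(unit_acquisition_move G)\<^sup>*\<^sup>* (initial_weight G) w"
    and "card {v \<in> pverts G. 0 < w v} \<le> n"
  shows "unit_acquisition_number G \<le> n"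
proof -
  have "unit_acquisition_number G \<le> card {v \<in> pverts G. 0 < w v}"
    unfolding unit_acquisition_number_def using assms(1) by (intro Least_le) blast
  then show ?thesis using assms(2) by simp
qed

lemma unit_acquisition_number_le_card_maximal_matching:
  assumes "pair_graph G" and no_isolated: "\<And>u. u \<in> pverts G \<Longrightarrow> \<exists>v. (u, v) \<in> parcs G"
    and M: "maximal_matching G M"
  shows "unit_acquisition_number G \<le> card M"
proof -
  interpret pair_graph G by fact
  have M_edges: "M \<subseteq> uedges G" and M_disj: "pairwise disjnt M"
    using M by (auto simp: maximal_matching_def matching_def)
  have "finite M" using M_edges finite_uedges pair_finite_arcs finite_subset by blast
  have cover_verts: "\<Union>M \<subseteq> pverts G"
    using M_edges in_arcsD1 in_arcsD2 by (auto simp: uedges_def)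
  let ?U = "pverts G - \<Union>M"
  obtain w1 where w1: "(unit_acquisition_move G)\<^sup>*\<^sup>* (initial_weight G) w1"
    "\<forall>u\<in>?U. w1 u = 0"
  proof -
    have "\<exists>w'. (unit_acquisition_move G)\<^sup>*\<^sup>* (initial_weight G) w' \<and> (\<forall>u\<in>?U. w' u = 0) \<and>
      (\<forall>v\<in>\<Union>M. 1 \<le> w' v) \<and> (\<forall>x. x \<notin> ?U \<union> \<Union>M \<longrightarrow> w' x = initial_weight G x)"
    proof (rule drain_uncovered)
      fix u assume u: "u \<in> ?U"
      then obtain v where "(u, v) \<in> parcs G" using no_isolated by blast
      then show "\<exists>v\<in>\<Union>M. (u, v) \<in> parcs G"
        using uncovered_vertex_adjacent_to_covered[OF M] u by blast
    qed (use cover_verts pair_finite_verts in \<open>auto simp: initial_weight_def\<close>)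
    then show ?thesis using that by blast
  qed
  have "(v, v) \<notin> parcs G" for v using no_loops' by blast
  then obtain w2 where w2: "(unit_acquisition_move G)\<^sup>*\<^sup>* w1 w2"
    "\<forall>e\<in>M. card {v\<in>e. 0 < w2 v} \<le> 1" "\<forall>x. x \<notin> \<Union>M \<longrightarrow> w2 x = w1 x"
    using collapse_matching[OF \<open>finite M\<close> M_edges M_disj _ arcs_symmetric, of w1] by blast
  have "v \<in> \<Union>M" if "v \<in> pverts G" "0 < w2 v" for v
    using that w1(2) w2(3) by (metis DiffI less_irrefl)
  then have "{v \<in> pverts G. 0 < w2 v} \<subseteq> (\<Union>e\<in>M. {v\<in>e. 0 < w2 v})" by blast
  moreover have "finite (\<Union>e\<in>M. {v\<in>e. 0 < w2 v})"
    by (rule finite_subset[OF _ pair_finite_verts]) (use cover_verts in blast)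
  ultimately have "card {v \<in> pverts G. 0 < w2 v} \<le> card (\<Union>e\<in>M. {v\<in>e. 0 < w2 v})"
    by (rule card_mono[rotated])
  also have "\<dots> \<le> (\<Sum>e\<in>M. card {v\<in>e. 0 < w2 v})" by (rule card_UN_le[OF \<open>finite M\<close>])
  also have "\<dots> \<le> (\<Sum>e\<in>M. 1)" by (rule sum_mono) (use w2(2) in blast)
  finally have "card {v \<in> pverts G. 0 < w2 v} \<le> card M" by simp
  moreover have "(unit_acquisition_move G)\<^sup>*\<^sup>* (initial_weight G) w2" using w1(1) w2(1) by simp
  ultimately show ?thesis by (intro unit_acquisition_number_le)
qed

lemma maximal_matching_exists:
  assumes "pair_graph G"
  shows "\<exists>M. maximal_matching G M"
proof -
  interpret pair_graph G by fact
  have "finite (uedges G)" using finite_uedges pair_finite_arcs .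
  then have "finite {M. matching G M}"
    by (rule finite_subset[rotated, OF finite_Pow_iff[THEN iffD2]]) (auto simp: matching_def)
  moreover have "{M. matching G M} \<noteq> {}"
    by (auto simp: matching_def intro!: exI[of _ "{}"])
  ultimately obtain M where "matching G M" "\<forall>M'. matching G M' \<longrightarrow> M \<subseteq> M' \<longrightarrow> M = M'"
    using finite_has_maximal[of "{M. matching G M}"] by auto
  then show ?thesis by (auto simp: maximal_matching_def)
qed

lemma unit_acquisition_number_le_min_maximal_matching_size:
  assumes "pair_graph G" "connected (with_proj G)" "2 \<le> card (pverts G)"
  shows "unit_acquisition_number G \<le> min_maximal_matching_size G"
proof -
  have "\<exists>n M. maximal_matching G M \<and> card M = n"
    using maximal_matching_exists[OF assms(1)] by blast
  then have "\<exists>M. maximal_matching G M \<and> card M = min_maximal_matching_size G"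
    unfolding min_maximal_matching_size_def by (rule LeastI_ex)
  then obtain M where "maximal_matching G M" "card M = min_maximal_matching_size G" by blast
  then show ?thesis
    using unit_acquisition_number_le_card_maximal_matching
      connected_imp_no_isolated_vertex assms by metis
qed

section \<open>A lower bound from pendant vertices\<close>

text \<open>
  The vertices that are counted: the live members of \<open>C\<close> (the centres), together with the positive
  vertices outside \<open>C\<close> all of whose neighbours are dead. The latter can take part in no further move.
\<close>

definition settled :: "'a pair_pre_digraph \<Rightarrow> 'a set \<Rightarrow> ('a \<Rightarrow> nat) \<Rightarrow> 'a set" where
  "settled G C w =
    {v \<in> pverts G. 0 < w v \<and> (v \<in> C \<or> (\<forall>u. (v, u) \<in> parcs G \<longrightarrow> w u = 0))}"

text \<open>
  In a bipartite graph with side \<open>C\<close>, the first conjunct says that a leaf that has received weight has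
  at most one live centre left, and the second provides each centre of weight \<open>1\<close> with a neighbour
  that will be settled as soon as this centre dies.
\<close>

definition settling_invariant ::
    "'a pair_pre_digraph \<Rightarrow> 'a set \<Rightarrow> ('a \<Rightarrow> nat) \<Rightarrow> bool" where
  "settling_invariant G C w \<longleftrightarrow>
    (\<forall>v u u'. v \<notin> C \<and> 2 \<le> w v \<and> (v, u) \<in> parcs G \<and> (v, u') \<in> parcs G \<and>
       0 < w u \<and> 0 < w u' \<longrightarrow> u = u') \<and>
    (\<forall>c\<in>C. w c = 1 \<longrightarrow>
       (\<exists>v. (v, c) \<in> parcs G \<and> 0 < w v \<and> (\<forall>u. (v, u) \<in> parcs G \<and> u \<noteq> c \<longrightarrow> w u = 0))) \<and>
    card C \<le> card (settled G C w)"

text \<open>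
  The degree bound enters exactly once. When a leaf \<open>b\<close> rises from \<open>1\<close> to \<open>2\<close>, its donor drops to \<open>0\<close>,
  and at most two neighbours in total leave room for only one other live neighbour. The count can change to
  the worse only when a centre dies, and then the reserve of that centre makes up for the loss.
\<close>

lemma settling_invariant_step:
  assumes "pair_graph G"
    and bip: "\<And>u v. (u, v) \<in> parcs G \<Longrightarrow> u \<in> C \<longleftrightarrow> v \<notin> C"
    and deg: "\<And>v. v \<in> pverts G \<Longrightarrow> v \<notin> C \<Longrightarrow> card {u. (v, u) \<in> parcs G} \<le> 2"
    and inv: "settling_invariant G C w" and "unit_acquisition_move G w w'"
  shows "settling_invariant G C w'"
proof -
  interpret pair_graph G by fact
  have fin: "finite (settled G C x)" for x
    using pair_finite_verts by (simp add: settled_def)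
  have heavy: "u = u'" if "v \<notin> C" "2 \<le> w v" "(v, u) \<in> parcs G" "(v, u') \<in> parcs G"
      "0 < w u" "0 < w u'" for v u u'
    using inv that unfolding settling_invariant_def by blast
  have reserve: "\<exists>v. (v, c) \<in> parcs G \<and> 0 < w v \<and> (\<forall>u. (v, u) \<in> parcs G \<and> u \<noteq> c \<longrightarrow> w u = 0)"
    if "c \<in> C" "w c = 1" for c
    using inv that unfolding settling_invariant_def by blast
  have count: "card C \<le> card (settled G C w)"
    using inv unfolding settling_invariant_def by blast
  obtain a b where ab: "(a, b) \<in> parcs G" "0 < w a" "w a \<le> w b"
    and w': "w' = w(a := w a - 1, b := w b + 1)"
    using assms(5) unfolding unit_acquisition_move_def by blast
  have "a \<noteq> b" using ab(1) no_loops' by blast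
  have ba: "(b, a) \<in> parcs G" using ab(1) arcs_symmetric by blast
  have w'_simps: "w' a = w a - 1" "w' b = w b + 1" "\<And>x. x \<noteq> a \<Longrightarrow> x \<noteq> b \<Longrightarrow> w' x = w x"
    using \<open>a \<noteq> b\<close> by (auto simp: w')
  have zero: "w' x = 0" if "w x = 0" for x
    using that ab w'_simps by (cases "x = a"; cases "x = b") auto
  have pos: "0 < w x" if "0 < w' x" for x
    using that zero by fastforce
  \<comment> \<open>Either a centre gives to a leaf, or a leaf gives to a centre.\<close>
  show ?thesis
  proof (cases "a \<in> C")
    case True
    then have "b \<notin> C" using bip ab(1) by blast
    have heavy': "u = u'" if h: "v \<notin> C" "2 \<le> w' v" "(v, u) \<in> parcs G" "(v, u') \<in> parcs G"
      "0 < w' u" "0 < w' u'" for v u u'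
    proof (cases "v = b \<and> w b = 1")
      case not_first: False
      have "v \<noteq> a" using h(1) True by blast
      then have "2 \<le> w v" using not_first h(2) ab w'_simps by (cases "v = b") auto
      then show ?thesis using heavy h pos by blast
    next
      case b: True
      then have "w' a = 0" using ab w'_simps by simp
      then have ne: "u \<noteq> a" "u' \<noteq> a" using h by auto
      show ?thesis
      proof (rule ccontr)
        assume "u \<noteq> u'"
        have "{a, u, u'} \<subseteq> {x. (b, x) \<in> parcs G}" using h b ba by auto
        moreover have "finite {x. (b, x) \<in> parcs G}"
          using in_arcsD2 by (auto intro: finite_subset[OF _ pair_finite_verts])
        ultimately have "card {a, u, u'} \<le> card {x. (b, x) \<in> parcs G}"
          by (rule card_mono[rotated])
        also have "\<dots> \<le> 2" using deg \<open>b \<notin> C\<close> in_arcsD2[OF ab(1)] by blast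
        finally show False using ne \<open>u \<noteq> u'\<close> by auto
      qed
    qed
    have reserve': "\<exists>v. (v, c) \<in> parcs G \<and> 0 < w' v \<and>
        (\<forall>u. (v, u) \<in> parcs G \<and> u \<noteq> c \<longrightarrow> w' u = 0)" if c: "c \<in> C" "w' c = 1" for c
    proof (cases "c = a")
      \<comment> \<open>The donor drops from 2 to 1, so its recipient had weight at least 2 and becomes the reserve.\<close>
      case True
      then have "2 \<le> w b" using c ab w'_simps by simp
      then have "w u = 0" if "(b, u) \<in> parcs G" "u \<noteq> a" for u
        using heavy[OF \<open>b \<notin> C\<close> _ that(1) ba] that ab(2) by blast
      then show ?thesis using True ba w'_simps zero by (intro exI[of _ b]) auto
    next
      case False
      then have "w c = 1" using c \<open>b \<notin> C\<close> w'_simps by metis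
      then obtain v where v: "(v, c) \<in> parcs G" "0 < w v"
        "\<forall>u. (v, u) \<in> parcs G \<and> u \<noteq> c \<longrightarrow> w u = 0" using reserve c(1) by blast
      then have "v \<noteq> a" using \<open>a \<in> C\<close> bip c(1) by blast
      then have "0 < w' v" using v(2) w'_simps by (cases "v = b") auto
      then show ?thesis using v zero by blast
    qed
    have count': "card (settled G C w) \<le> card (settled G C w')"
    proof (cases "w a = 1")
      case False
      then have "0 < w' x" if "0 < w x" for x
        using that ab w'_simps by (cases "x = a"; cases "x = b") auto
      then have "settled G C w \<subseteq> settled G C w'" using zero by (auto simp: settled_def)
      then show ?thesis using fin card_mono by blast
    next
      case one: True
      obtain v where v: "(v, a) \<in> parcs G" "0 < w v"
        "\<forall>u. (v, u) \<in> parcs G \<and> u \<noteq> a \<longrightarrow> w u = 0" using reserve True one by blast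
      have "v \<notin> C" using v(1) True bip by blast
      then have "v \<notin> settled G C w" using v(1) one by (auto simp: settled_def)
      have "v \<noteq> a" using True \<open>v \<notin> C\<close> by blast
      have "0 < w' x" if "0 < w x" "x \<noteq> a" for x
        using that ab w'_simps by (cases "x = b") auto
      moreover have "w' a = 0" using one w'_simps by simp
      ultimately have "v \<in> settled G C w'" "settled G C w - {a} \<subseteq> settled G C w'"
        using v zero \<open>v \<noteq> a\<close> in_arcsD1[OF v(1)] unfolding settled_def by blast+
      then have "insert v (settled G C w - {a}) \<subseteq> settled G C w'" by blast
      then have "card (insert v (settled G C w - {a})) \<le> card (settled G C w')"
        using fin card_mono by blast
      moreover have "card (insert v (settled G C w - {a})) = Suc (card (settled G C w - {a}))"
        using \<open>v \<notin> settled G C w\<close> fin by simp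
      moreover have "a \<in> settled G C w"
        using True ab in_arcsD1 by (auto simp: settled_def)
      then have "card (settled G C w) = Suc (card (settled G C w - {a}))"
        using fin by (intro card.remove)
      ultimately show ?thesis by linarith
    qed
    show ?thesis unfolding settling_invariant_def
      using heavy' reserve' le_trans[OF count count'] by blast
  next
    case False
    then have "b \<in> C" using bip ab(1) by blast
    have heavy': "u = u'" if h: "v \<notin> C" "2 \<le> w' v" "(v, u) \<in> parcs G" "(v, u') \<in> parcs G"
      "0 < w' u" "0 < w' u'" for v u u'
    proof -
      have "2 \<le> w v" using h(1,2) w'_simps \<open>b \<in> C\<close> by (cases "v = a"; cases "v = b") auto
      then show ?thesis using heavy h pos by blast
    qed
    have reserve': "\<exists>v. (v, c) \<in> parcs G \<and> 0 < w' v \<and>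
        (\<forall>u. (v, u) \<in> parcs G \<and> u \<noteq> c \<longrightarrow> w' u = 0)" if c: "c \<in> C" "w' c = 1" for c
    proof -
      have "c \<noteq> b" using c ab w'_simps by auto
      then have "w c = 1" using c False w'_simps by metis
      then obtain v where v: "(v, c) \<in> parcs G" "0 < w v"
        "\<forall>u. (v, u) \<in> parcs G \<and> u \<noteq> c \<longrightarrow> w u = 0" using reserve c(1) by blast
      have "v \<noteq> a" using v(3) ab \<open>c \<noteq> b\<close> by fastforce
      then have "0 < w' v" using v(2) w'_simps by (cases "v = b") auto
      then show ?thesis using v zero by blast
    qed
    \<comment> \<open>A leaf that can give has a live neighbour, so losing its weight does not affect the count.\<close>
    have "a \<notin> settled G C w" using False ab by (auto simp: settled_def)
    moreover have "0 < w' x" if "0 < w x" "x \<noteq> a" for x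
      using that w'_simps by (cases "x = b") auto
    ultimately have "x \<in> settled G C w'" if "x \<in> settled G C w" for x
      using that zero unfolding settled_def by blast
    then have "settled G C w \<subseteq> settled G C w'" by blast
    then have "card (settled G C w) \<le> card (settled G C w')" using fin card_mono by blast
    then show ?thesis unfolding settling_invariant_def
      using heavy' reserve' le_trans[OF count] by blast
  qed
qed

text \<open>
  Initially no vertex has weight \<open>2\<close>, every vertex of \<open>C\<close> counts as settled, and the pendant
  neighbours serve as the reserves.
\<close>

lemma card_le_unit_acquisition_number:
  assumes "pair_graph G" and C: "C \<subseteq> pverts G"
    and bip: "\<And>u v. (u, v) \<in> parcs G \<Longrightarrow> u \<in> C \<longleftrightarrow> v \<notin> C"
    and deg: "\<And>v. v \<in> pverts G \<Longrightarrow> v \<notin> C \<Longrightarrow> card {u. (v, u) \<in> parcs G} \<le> 2"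
    and pendant: "\<And>c. c \<in> C \<Longrightarrow> \<exists>v. {u. (v, u) \<in> parcs G} = {c}"
  shows "card C \<le> unit_acquisition_number G"
proof -
  interpret pair_graph G by fact
  have start: "settling_invariant G C (initial_weight G)"
  proof -
    have "C \<subseteq> settled G C (initial_weight G)"
      using C by (auto simp: settled_def initial_weight_def)
    then have "card C \<le> card (settled G C (initial_weight G))"
      using pair_finite_verts by (intro card_mono) (auto simp: settled_def)
    moreover have "\<exists>v. (v, c) \<in> parcs G \<and> 0 < initial_weight G v \<and>
        (\<forall>u. (v, u) \<in> parcs G \<and> u \<noteq> c \<longrightarrow> initial_weight G u = 0)" if "c \<in> C" for c
    proof -
      obtain v where v: "{u. (v, u) \<in> parcs G} = {c}" using pendant[OF \<open>c \<in> C\<close>] by blast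
      then have "(v, c) \<in> parcs G" by blast
      then have "v \<in> pverts G" by (rule in_arcsD1)
      then show ?thesis using v by (intro exI[of _ v]) (auto simp: initial_weight_def)
    qed
    ultimately show ?thesis
      by (auto simp: settling_invariant_def initial_weight_def)
  qed
  have inv: "settling_invariant G C w"
    if "(unit_acquisition_move G)\<^sup>*\<^sup>* (initial_weight G) w" for w
    using that
  proof (induction rule: rtranclp_induct)
    case base
    show ?case by (rule start)
  next
    case (step y z)
    then show ?case using settling_invariant_step[OF assms(1) bip deg] by blast
  qed
  have "card C \<le> card {v \<in> pverts G. 0 < w v}"
    if "(unit_acquisition_move G)\<^sup>*\<^sup>* (initial_weight G) w" for w
  proof -
    have "card C \<le> card (settled G C w)"
      using inv[OF that] by (simp add: settling_invariant_def)
    also have "\<dots> \<le> card {v \<in> pverts G. 0 < w v}"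
      using pair_finite_verts by (intro card_mono) (auto simp: settled_def)
    finally show ?thesis .
  qed
  moreover have "\<exists>n w. (unit_acquisition_move G)\<^sup>*\<^sup>* (initial_weight G) w \<and>
      card {v \<in> pverts G. 0 < w v} = n" by blast
  then have "\<exists>w. (unit_acquisition_move G)\<^sup>*\<^sup>* (initial_weight G) w \<and>
      card {v \<in> pverts G. 0 < w v} = unit_acquisition_number G"
    unfolding unit_acquisition_number_def by (rule LeastI_ex)
  ultimately show ?thesis by metis
qed

section \<open>Chains of stars\<close>

text \<open>
  The block \<open>{i * k..i * k + k}\<close> induces a star with centre \<open>i * k + 1\<close>. Its endpoints are multiples of
  \<open>k\<close> and belong to two consecutive blocks, except for the two ends of the whole chain. The first and
  the last star therefore need no special treatment: every centre has exactly \<open>k\<close> neighbours. For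
  \<open>k \<ge> 3\<close> the vertex \<open>i * k + 2\<close> lies in one block only and is pendant.
\<close>

definition star_chain :: "nat \<Rightarrow> nat \<Rightarrow> nat pair_pre_digraph" where
  "star_chain m k = \<lparr>pverts = {..m * k},
    parcs = {(u, v). \<exists>i<m. u = i * k + 1 \<and> v \<in> {i * k..i * k + k} - {i * k + 1} \<or>
      v = i * k + 1 \<and> u \<in> {i * k..i * k + k} - {i * k + 1}}\<rparr>"

lemma pverts_star_chain: "pverts (star_chain m k) = {..m * k}"
  by (simp add: star_chain_def)

lemma star_chain_arc_iff:
  "(u, v) \<in> parcs (star_chain m k) \<longleftrightarrow>
    (\<exists>i<m. u = i * k + 1 \<and> v \<in> {i * k..i * k + k} - {i * k + 1} \<or>
      v = i * k + 1 \<and> u \<in> {i * k..i * k + k} - {i * k + 1})"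
  by (simp add: star_chain_def)

lemma mult_add_mod:
  fixes r k :: nat
  shows "r < k \<Longrightarrow> (i * k + r) mod k = r"
  by simp

lemma centre_mod:
  fixes k :: nat
  shows "2 \<le> k \<Longrightarrow> (i * k + 1) mod k = 1"
  by (rule mult_add_mod) simp

lemma leaf_mod:
  fixes k :: nat
  assumes "2 \<le> k" "x \<in> {i * k..i * k + k} - {i * k + 1}"
  shows "x mod k \<noteq> 1"
proof -
  obtain r where r: "x = i * k + r" "r \<le> k" "r \<noteq> 1"
    using assms(2) by (metis DiffE add_le_cancel_left atLeastAtMost_iff le_Suc_ex singletonI)
  then have "x mod k = r mod k" by simp
  then show ?thesis using r assms(1) by (cases "r = k") auto
qed

lemma block_le:
  fixes k :: nat
  assumes "i < m" "x \<le> i * k + k"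
  shows "x \<le> m * k"
proof -
  have "Suc i * k \<le> m * k" using assms(1) by (intro mult_le_mono1) simp
  then show ?thesis using assms(2) by simp
qed

lemma star_chain_pair_graph: "2 \<le> k \<Longrightarrow> pair_graph (star_chain m k)"
proof -
  assume k: "2 \<le> k"
  have arc: "u \<le> m * k \<and> v \<le> m * k \<and> u \<noteq> v \<and> (v, u) \<in> parcs (star_chain m k)"
    if uv: "(u, v) \<in> parcs (star_chain m k)" for u v
  proof -
    obtain i where "i < m" "u \<le> i * k + k" "v \<le> i * k + k" "u \<noteq> v"
      using uv k by (auto simp: star_chain_arc_iff)
    moreover have "(v, u) \<in> parcs (star_chain m k)" using uv by (auto simp: star_chain_arc_iff)
    ultimately show ?thesis using block_le by blast
  qed
  have "finite (parcs (star_chain m k))"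
    by (rule finite_subset[of _ "{..m * k} \<times> {..m * k}"]) (use arc in auto)
  then show ?thesis
    using arc by unfold_locales (auto simp: pverts_star_chain symmetric_def intro!: symI)
qed

text \<open>Centres are \<open>1\<close> modulo \<open>k\<close>, and no other vertex of a block is.\<close>

lemma star_chain_bipartite:
  assumes "2 \<le> k" "(u, v) \<in> parcs (star_chain m k)"
  shows "u \<in> (\<lambda>i. i * k + 1) ` {..<m} \<longleftrightarrow> v \<notin> (\<lambda>i. i * k + 1) ` {..<m}"
proof -
  have no: "x \<notin> (\<lambda>i. i * k + 1) ` {..<m}" if "x \<in> {i * k..i * k + k} - {i * k + 1}" for x i
    using leaf_mod[OF assms(1) that] centre_mod[OF assms(1)] by auto
  obtain i where "i < m" "u = i * k + 1 \<and> v \<in> {i * k..i * k + k} - {i * k + 1} \<or>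
      v = i * k + 1 \<and> u \<in> {i * k..i * k + k} - {i * k + 1}"
    using assms(2) unfolding star_chain_arc_iff by blast
  then show ?thesis using no by blast
qed

lemma star_chain_centre_neighbours:
  assumes "2 \<le> k" "i < m"
  shows "{v. (i * k + 1, v) \<in> parcs (star_chain m k)} = {i * k..i * k + k} - {i * k + 1}"
proof -
  have "j = i" if "j * k + 1 = i * k + 1" for j
    using that assms(1) by simp
  moreover have "i * k + 1 \<notin> {j * k..j * k + k} - {j * k + 1}" for j
    using leaf_mod[OF assms(1)] centre_mod[OF assms(1)] by blast
  ultimately have "(i * k + 1, v) \<in> parcs (star_chain m k) \<longleftrightarrow>
      v \<in> {i * k..i * k + k} - {i * k + 1}" for v
    using assms(2) unfolding star_chain_arc_iff by metis
  then show ?thesis by blast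
qed

lemma star_chain_leaf_neighbours:
  assumes "2 \<le> k" "x \<notin> (\<lambda>i. i * k + 1) ` {..<m}"
  shows "{v. (x, v) \<in> parcs (star_chain m k)} =
    (\<lambda>i. i * k + 1) ` {i. i < m \<and> x \<in> {i * k..i * k + k}}"
  using assms(2) unfolding star_chain_arc_iff by blast

text \<open>Only at a multiple of \<open>k\<close> do two blocks meet.\<close>

lemma block_index:
  fixes k :: nat
  assumes "x \<in> {i * k..i * k + k}" "0 < k"
  shows "i = x div k \<or> i = x div k - 1 \<and> k dvd x"
proof -
  obtain r where r: "x = i * k + r" "r \<le> k"
    using assms(1) by (metis add_le_cancel_left atLeastAtMost_iff le_Suc_ex)
  show ?thesis
  proof (cases "r = k")
    case True
    then have "x = (i + 1) * k" using r by simp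
    then show ?thesis using assms(2) by (metis add_diff_cancel_right' div_mult_self_is_m dvd_triv_right)
  next
    case False
    then show ?thesis using r assms(2) by simp
  qed
qed

lemma star_chain_leaf_degree:
  assumes "2 \<le> k" "x \<notin> (\<lambda>i. i * k + 1) ` {..<m}"
  shows "card {v. (x, v) \<in> parcs (star_chain m k)} \<le> 2"
proof -
  have "{i. i < m \<and> x \<in> {i * k..i * k + k}} \<subseteq> {x div k, x div k - 1}"
    using block_index assms(1) by fastforce
  then have "{v. (x, v) \<in> parcs (star_chain m k)} \<subseteq> (\<lambda>i. i * k + 1) ` {x div k, x div k - 1}"
    unfolding star_chain_leaf_neighbours[OF assms] by (rule image_mono)
  then have "card {v. (x, v) \<in> parcs (star_chain m k)} \<le>
      card ((\<lambda>i. i * k + 1) ` {x div k, x div k - 1})"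
    by (rule card_mono[rotated]) simp
  also have "\<dots> \<le> card {x div k, x div k - 1}" by (rule card_image_le) simp
  also have "\<dots> \<le> 2" by (simp add: card_insert_if)
  finally show ?thesis .
qed

lemma star_chain_pendant:
  assumes "3 \<le> k" "i < m"
  shows "{v. (i * k + 2, v) \<in> parcs (star_chain m k)} = {i * k + 1}"
proof -
  have mod2: "(i * k + 2) mod k = 2" by (rule mult_add_mod) (use assms(1) in simp)
  have "i * k + 2 \<notin> (\<lambda>i. i * k + 1) ` {..<m}"
  proof
    assume "i * k + 2 \<in> (\<lambda>i. i * k + 1) ` {..<m}"
    then obtain j where "i * k + 2 = j * k + 1" by blast
    then have "(i * k + 2) mod k = 1" using centre_mod[of k j] assms(1) by simp
    then show False using mod2 by linarith
  qed
  moreover have "{j. j < m \<and> i * k + 2 \<in> {j * k..j * k + k}} = {i}"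
  proof -
    have "j = i" if "i * k + 2 \<in> {j * k..j * k + k}" for j
    proof -
      have "\<not> k dvd i * k + 2" using mod2 by (simp add: dvd_eq_mod_eq_0)
      then have "j = (i * k + 2) div k" using block_index[OF that] assms(1) by linarith
      then have "j * k + 2 = i * k + 2" using mod2 by (metis div_mult_mod_eq)
      then show ?thesis using assms(1) by simp
    qed
    then show ?thesis using assms by auto
  qed
  ultimately show ?thesis using star_chain_leaf_neighbours assms(1) by simp
qed

lemma out_degree_with_proj: "out_degree (with_proj G) u = card {v. (u, v) \<in> parcs G}"
proof -
  have "out_arcs (with_proj G) u = Pair u ` {v. (u, v) \<in> parcs G}"
    by (auto simp: out_arcs_def)
  then show ?thesis by (simp add: out_degree_def card_image inj_on_def)
qed

lemma max_degree_star_chain: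
  assumes "3 \<le> k" "1 \<le> m"
  shows "max_degree (star_chain m k) = k"
proof -
  have k: "2 \<le> k" using assms(1) by simp
  have deg: "card {v. (i * k + 1, v) \<in> parcs (star_chain m k)} = k" if "i < m" for i
    using star_chain_centre_neighbours[OF k that] k by simp
  have "1 \<le> m * k" using assms by simp
  moreover have "card {v. (x, v) \<in> parcs (star_chain m k)} \<le> k" for x
  proof (cases "x \<in> (\<lambda>i. i * k + 1) ` {..<m}")
    case True
    then show ?thesis using deg by auto
  next
    case False
    then show ?thesis using star_chain_leaf_degree[OF k False] k by simp
  qed
  ultimately show ?thesis
    unfolding max_degree_def out_degree_with_proj pverts_star_chain
    using deg[of 0] assms(2) by (intro Max_eqI) (auto intro!: image_eqI[of _ _ 1])
qed

text \<open>Each star is connected, and walking from one shared leaf to the next reaches every block.\<close>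

lemma star_chain_connected:
  assumes "3 \<le> k"
  shows "connected (with_proj (star_chain m k))"
proof -
  interpret pair_graph "star_chain m k" using star_chain_pair_graph assms by simp
  let ?G = "with_proj (star_chain m k)"
  have to_centre: "x \<rightarrow>\<^sup>*\<^bsub>?G\<^esub> (i * k + 1)" if "i < m" "x \<in> {i * k..i * k + k}" for i x
  proof (cases "x = i * k + 1")
    case True
    then show ?thesis using block_le that by (simp add: pverts_star_chain)
  next
    case False
    then have "(x, i * k + 1) \<in> parcs (star_chain m k)" 
      using that by (auto simp: star_chain_arc_iff)
    then show ?thesis by (intro reachable_adjI) simp
  qed
  have block: "x \<rightarrow>\<^sup>*\<^bsub>?G\<^esub> y" if "i < m" "x \<in> {i * k..i * k + k}" "y \<in> {i * k..i * k + k}" for i x y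
    using to_centre that symmetric_reachable' reachable_trans by blast
  have joint: "0 \<rightarrow>\<^sup>*\<^bsub>?G\<^esub> (i * k)" if "i \<le> m" for i
    using that
  proof (induction i)
    case 0
    then show ?case by (simp add: pverts_star_chain)
  next
    case (Suc i)
    have "(i * k) \<rightarrow>\<^sup>*\<^bsub>?G\<^esub> (Suc i * k)" using Suc.prems by (intro block[of i]) auto
    then show ?case using Suc reachable_trans by auto
  qed
  have root: "0 \<rightarrow>\<^sup>*\<^bsub>?G\<^esub> x" if "x \<le> m * k" for x
  proof (cases "x = m * k")
    case True
    then show ?thesis using joint by simp
  next
    case False
    define i where "i = x div k"
    have "i < m" using False that assms by (simp add: i_def less_mult_imp_div_less)
    moreover have "x = i * k + x mod k" "x mod k < k" using assms by (simp_all add: i_def)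
    then have "x \<in> {i * k..i * k + k}" by auto
    ultimately have "(i * k) \<rightarrow>\<^sup>*\<^bsub>?G\<^esub> x" by (intro block) auto
    then show ?thesis using joint \<open>i < m\<close> reachable_trans less_imp_le by blast
  qed
  have "u \<rightarrow>\<^sup>*\<^bsub>?G\<^esub> v" if "u \<in> pverts (star_chain m k)" "v \<in> pverts (star_chain m k)" for u v
    using root that symmetric_reachable' reachable_trans unfolding pverts_star_chain by blast
  then show ?thesis
    by (intro connectedI reachable_mk_symmetricI) (auto simp: pverts_star_chain)
qed

text \<open>Every edge contains a centre, and all centres are covered, so no edge can be added.\<close>

lemma star_chain_maximal_matching:
  fixes m k :: nat
  assumes "3 \<le> k"
  defines "M \<equiv> (\<lambda>i. {i * k + 1, i * k + 2}) ` {..<m}"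
  shows "maximal_matching (star_chain m k) M" "card M = m"
proof -
  have k: "2 \<le> k" using assms(1) by simp
  have disj: "{i * k + 1, i * k + 2} \<inter> {j * k + 1, j * k + 2} = {}" if "i \<noteq> j" for i j
  proof -
    have "(j * k + 1) mod k = 1" "(j * k + 2) mod k = 2" for j
      by (rule mult_add_mod; use assms(1) in simp)+
    then have "i * k + 1 \<noteq> j * k + 2" "i * k + 2 \<noteq> j * k + 1" by (metis one_eq_numeral_iff num.distinct(1))+
    then show ?thesis using that k by auto
  qed
  then have "inj_on (\<lambda>i. {i * k + 1, i * k + 2}) {..<m}"
    by (intro inj_onI) (metis Int_absorb insert_not_empty)
  then show "card M = m" by (simp add: M_def card_image)
  have "(i * k + 1, i * k + 2) \<in> parcs (star_chain m k)" if "i < m" for i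
    using that assms(1) by (auto simp: star_chain_arc_iff)
  then have "M \<subseteq> uedges (star_chain m k)" by (auto simp: M_def uedges_def)
  moreover have "pairwise disjnt M"
  proof (rule pairwiseI)
    fix e f
    assume "e \<in> M" "f \<in> M" "e \<noteq> f"
    then obtain i j where ij: "e = {i * k + 1, i * k + 2}" "f = {j * k + 1, j * k + 2}"
      unfolding M_def by blast
    then have "i \<noteq> j" using \<open>e \<noteq> f\<close> by blast
    then show "disjnt e f" unfolding disjnt_def ij by (rule disj)
  qed
  ultimately have matching: "matching (star_chain m k) M" by (simp add: matching_def)
  have "\<not> M \<subset> M'" if M': "matching (star_chain m k) M'" for M'
  proof
    assume "M \<subset> M'"
    then obtain e where e: "e \<in> M'" "e \<notin> M" by blast
    then obtain u v where uv: "e = {u, v}" "(u, v) \<in> parcs (star_chain m k)"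
      using M' by (auto simp: matching_def uedges_def)
    then obtain i where i: "i < m" "i * k + 1 \<in> e"
      using star_chain_bipartite[OF k uv(2)] by blast
    then have "{i * k + 1, i * k + 2} \<in> M'" "{i * k + 1, i * k + 2} \<noteq> e"
      using \<open>M \<subset> M'\<close> e(2) by (auto simp: M_def)
    moreover have "pairwise disjnt M'" using M' by (simp add: matching_def)
    ultimately have "disjnt {i * k + 1, i * k + 2} e"
      using e(1) by (metis pairwiseD)
    then show False using i(2) by (simp add: disjnt_def)
  qed
  then show "maximal_matching (star_chain m k) M"
    using matching by (auto simp: maximal_matching_def)
qed

lemma star_chain_unit_acquisition_number_ge:
  assumes "3 \<le> k"
  shows "m \<le> unit_acquisition_number (star_chain m k)"
proof -
  have k: "2 \<le> k" using assms by simp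
  let ?C = "(\<lambda>i. i * k + 1) ` {..<m}"
  have "card ?C \<le> unit_acquisition_number (star_chain m k)"
  proof (rule card_le_unit_acquisition_number)
    show "?C \<subseteq> pverts (star_chain m k)"
      using block_le k by (auto simp: pverts_star_chain)
    show "\<exists>v. {u. (v, u) \<in> parcs (star_chain m k)} = {c}" if "c \<in> ?C" for c
      using that star_chain_pendant[OF assms] by blast
  qed (use star_chain_pair_graph star_chain_bipartite star_chain_leaf_degree k in blast)+
  moreover have "inj_on (\<lambda>i. i * k + 1) {..<m}" using k by (auto intro: inj_onI)
  ultimately show ?thesis by (simp add: card_image)
qed

theorem proposition2p8:
  shows
    "(\<forall>G :: 'a pair_pre_digraph.
        pair_graph G \<and> connected (with_proj G) \<and> 2 \<le> card (pverts G) \<longrightarrow>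
        unit_acquisition_number G \<le> min_maximal_matching_size G) \<and>
     (\<forall>m k :: nat. 1 \<le> m \<and> 4 \<le> k \<longrightarrow>
        (\<exists>G :: nat pair_pre_digraph.
           pair_graph G \<and> connected (with_proj G) \<and> max_degree G = k \<and>
           (\<exists>M. maximal_matching G M \<and> card M = m) \<and>
           unit_acquisition_number G = m \<and>
           unit_acquisition_number G = min_maximal_matching_size G))"
proof (intro conjI allI impI; elim conjE)
  fix G :: "'a pair_pre_digraph"
  assume "pair_graph G" "connected (with_proj G)" "2 \<le> card (pverts G)"
  then show "unit_acquisition_number G \<le> min_maximal_matching_size G"
    by (rule unit_acquisition_number_le_min_maximal_matching_size)
next
  fix m k :: nat
  assume mk: "1 \<le> m" "4 \<le> k"
  let ?G = "star_chain m k"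
  have k: "3 \<le> k" "2 \<le> k" using mk by simp_all
  note graph = star_chain_pair_graph[OF k(2)] star_chain_connected[OF k(1)]
  have "1 \<le> m * k" using mk by simp
  then have "2 \<le> card (pverts ?G)" by (simp add: pverts_star_chain)
  then have "unit_acquisition_number ?G \<le> min_maximal_matching_size ?G"
    using graph unit_acquisition_number_le_min_maximal_matching_size by blast
  moreover have "min_maximal_matching_size ?G \<le> m"
    unfolding min_maximal_matching_size_def
    using star_chain_maximal_matching[OF k(1)] by (intro Least_le) blast
  moreover have "m \<le> unit_acquisition_number ?G"
    using star_chain_unit_acquisition_number_ge[OF k(1)] .
  ultimately have "unit_acquisition_number ?G = m"
    "unit_acquisition_number ?G = min_maximal_matching_size ?G" by simp_all
  then show "\<exists>G :: nat pair_pre_digraph.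
           pair_graph G \<and> connected (with_proj G) \<and> max_degree G = k \<and>
           (\<exists>M. maximal_matching G M \<and> card M = m) \<and>
           unit_acquisition_number G = m \<and>
           unit_acquisition_number G = min_maximal_matching_size G"
    using graph max_degree_star_chain[OF k(1) mk(1)] star_chain_maximal_matching[OF k(1)]
    by (intro exI[of _ ?G]) blast
qed

end
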